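(* Let $n\ge 1$ be an integer and let $z\in\mathbb{R}$ be a simple zero (i.e. $f(z)=0$, $f'(z)\neq 0$) of a real function $f$ of one real variable which is continuously differentiable up to order $n+2$ in a neighborhood of $z$. Then the Newton--Cotes closed iterative function $t_n$, defined recursively starting from Newton's function $t_0(x)=x-f(x)/f'(x)$, has local order of convergence at least $n+2$ at $z$; that is, $t_n(z)=z$ and $t_n^{(j)}(z)=0$ for $1\le j\le n+1$.
   Context: Newton--Cotes weights: for $m\ge 1$, let $A_0^{[m]},\dots,A_m^{[m]}$ be the weights of the closed Newton--Cotes quadrature rule with $m+1$ equally spaced nodes, and let $c_m=\sum_{i=0}^m A_i^{[m]}$. That is, for all real $a,b$ the rule $\int_a^b g(t)\,dt\approx \frac{b-a}{c_m}\sum_{i=0}^m A_i^{[m]}\, g\!\left(a+i\,\frac{b-a}{m}\right)$ is exact for all polynomials $g$ of degree at most $m$; the weights are normalized so that $c_m$ is the least positive integer for which all $A_i^{[m]}$ are integers. Recursive iterative functions: $t_0(x)=x-f(x)/f'(x)$, and for $m\ge 1$, $$h_m(x)=\frac{t_{m-1}(x)-x}{m},\qquad B_m(x)=\sum_{i=0}^m A_i^{[m]}\, f'(x+i\,h_m(x)),\qquad t_m(x)=x-c_m\,\frac{f(x)}{B_m(x)},$$ these functions being considered in a sufficiently small neighborhood of $z$. Convergence order: an iterative function $t$ has (local) convergence order at least $p$ at $z$ if $t(z)=z$ and $t^{(j)}(z)=0$ for $1\le j\le p-1$. *)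

theory Defs
  imports "HOL-Analysis.Analysis" "HOL-Computational_Algebra.Polynomial"
begin

definition closed_newton_cotes_rule :: "nat \<Rightarrow> (nat \<Rightarrow> real) \<Rightarrow> bool" where
  "closed_newton_cotes_rule m w \<longleftrightarrow>
     (\<forall>(a::real) (b::real) (p::real poly). degree p \<le> m \<longrightarrow>
        (LBINT t=ereal a..ereal b. poly p t) =
          (b - a) * (\<Sum>i\<le>m. w i * poly p (a + real i * ((b - a) / real m))))"

text \<open>
  The weights \<open>A\<close> are the numerators over the common denominator \<open>\<Sum>i\<le>m. A i\<close>, which has to
  be the least one.  Only the values \<open>A 0, \<dots>, A m\<close> are constrained; they may be negative
  (as for \<open>m = 8\<close>).
\<close>

definition newton_cotes_weights :: "nat \<Rightarrow> (nat \<Rightarrow> int) \<Rightarrow> bool" where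
  "newton_cotes_weights m A \<longleftrightarrow>
     (let c = (\<Sum>i\<le>m. A i); w = (\<lambda>i. real_of_int (A i) / real_of_int c) in
        closed_newton_cotes_rule m w \<and>
        0 < c \<and>
        (\<forall>d>0. (\<forall>i\<le>m. real_of_int d * w i \<in> \<int>) \<longrightarrow> c \<le> d))"

text \<open>Such weights exist for every \<open>m \<ge> 1\<close>.\<close>

lemma poly_antiderivative_exists:
  fixes p :: "real poly"
  shows "\<exists>P. pderiv P = p \<and>
           ((\<forall>k. coeff p k \<in> \<rat>) \<longrightarrow> (\<forall>k. coeff P k \<in> \<rat>))"
proof -
  define P where "P = (\<Sum>k\<le>degree p. monom (coeff p k / real (Suc k)) (Suc k))"
  have "pderiv P = (\<Sum>k\<le>degree p. monom (coeff p k) k)"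
    unfolding P_def by (simp add: higher_pderiv_sum [of 1, simplified] pderiv_monom del: of_nat_Suc)
  then have "pderiv P = p" by (simp add: poly_as_sum_of_monoms)
  moreover have "coeff P k \<in> \<rat>" if "\<forall>k. coeff p k \<in> \<rat>" for k
    unfolding P_def coeff_sum
    by (rule Rats_sum) (use that in \<open>auto simp del: of_nat_Suc\<close>)
  ultimately show ?thesis by blast
qed

lemma LBINT_pderiv:
  fixes P :: "real poly"
  shows "(LBINT t=ereal a..ereal b. poly (pderiv P) t) = poly P b - poly P a"
  by (rule interval_integral_FTC_finite)
    (auto intro!: continuous_intros has_field_derivative_at_within [OF poly_DERIV]
      simp: has_real_derivative_iff_has_vector_derivative [symmetric])

lemma pderiv_eq_imp_diff_eq:
  fixes P Q :: "real poly"
  assumes "pderiv P = pderiv Q"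
  shows "poly P b - poly P a = poly Q b - poly Q a"
  by (metis assms LBINT_pderiv)

lemma rational_poly_prod:
  fixes q :: "'a \<Rightarrow> real poly"
  assumes "\<And>i k. i \<in> S \<Longrightarrow> coeff (q i) k \<in> \<rat>"
  shows "coeff (\<Prod>i\<in>S. q i) k \<in> \<rat>"
  using assms
proof (induction S arbitrary: k rule: infinite_finite_induct)
  case (insert x F)
  then show ?case
    by (auto simp: coeff_mult intro!: Rats_sum Rats_mult)
qed (auto simp: coeff_1)

lemma rational_poly_eval:
  fixes p :: "real poly"
  assumes "\<And>k. coeff p k \<in> \<rat>" "x \<in> \<rat>"
  shows "poly p x \<in> \<rat>"
  unfolding poly_altdef by (intro Rats_sum Rats_mult Rats_power assms)

lemma closed_newton_cotes_rule_exists: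
  assumes m: "m \<ge> 1"
  shows "\<exists>w. closed_newton_cotes_rule m w \<and> (\<forall>i\<le>m. w i \<in> \<rat>)"
proof -
  define l :: "nat \<Rightarrow> real poly" where
    "l i = (\<Prod>j\<in>{..m} - {i}. [:- real j / (real i - real j), 1 / (real i - real j):])" for i
  have l_rat: "coeff (l i) k \<in> \<rat>" for i k
    unfolding l_def by (rule rational_poly_prod) (auto simp: coeff_pCons split: nat.splits)
  have l_deg: "degree (l i) \<le> m" if "i \<le> m" for i
  proof -
    have "degree (l i) \<le> (\<Sum>j\<in>{..m} - {i}. 1)"
      unfolding l_def
      by (rule order.trans [OF degree_prod_sum_le]) (auto intro!: sum_mono)
    then show ?thesis using that by simp
  qed
  have l_eval: "poly (l i) (real j) = (if i = j then 1 else 0)" if "i \<le> m" "j \<le> m" for i j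
  proof (cases "i = j")
    case True
    have "poly (l i) (real i) = (\<Prod>j\<in>{..m} - {i}. 1)"
      unfolding l_def poly_prod 
    proof (rule prod.cong)
      fix j assume "j \<in> {..m} - {i}"
      then have "real i - real j \<noteq> 0" by auto
      then have "real i / (real i - real j) - real j / (real i - real j) = 1"
        by (subst diff_divide_distrib [symmetric]) simp
      then show "poly [:- real j / (real i - real j), 1 / (real i - real j):] (real i) = 1"
        by simp
    qed simp
    then show ?thesis using True by simp
  next
    case False
    then have "\<exists>k\<in>{..m} - {i}.
        poly [:- real k / (real i - real k), 1 / (real i - real k):] (real j) = 0"
      using that by (intro bexI [of _ j]) auto
    then show ?thesis using False unfolding l_def poly_prod by (subst prod_zero) auto
  qed
  have "\<exists>P. pderiv P = l i \<and> (\<forall>k. coeff P k \<in> \<rat>)" for i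
    using poly_antiderivative_exists [of "l i"] l_rat by simp
  then have "\<exists>M. \<forall>i. pderiv (M i) = l i \<and> (\<forall>k. coeff (M i) k \<in> \<rat>)"
    by (intro choice) blast
  then obtain M where M: "\<And>i. pderiv (M i) = l i" and M_rat: "\<And>i k. coeff (M i) k \<in> \<rat>"
    by blast
  define w where "w i = (poly (M i) (real m) - poly (M i) 0) / real m" for i
  have "w i \<in> \<rat>" for i
    unfolding w_def by (intro Rats_divide Rats_diff rational_poly_eval M_rat) auto
  moreover have "closed_newton_cotes_rule m w"
    unfolding closed_newton_cotes_rule_def
  proof (intro allI impI)
    fix a b :: real and p :: "real poly"
    assume p: "degree p \<le> m"
    define d where "d = (b - a) / real m"
    define q where "q = pcompose p [:a, d:]"
    have "degree q \<le> degree p * degree [:a, d:]"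
      unfolding q_def by (rule degree_pcompose_le)
    also have "\<dots> \<le> degree p * 1" by (intro mult_left_mono) auto
    finally have q_deg: "degree q \<le> m" using p by simp
    have q: "q = (\<Sum>i\<le>m. smult (poly q (real i)) (l i))"
    proof (rule poly_eqI_degree [of "real ` {..m}"])
      have "card (real ` {..m}) = Suc m" by (simp add: card_image inj_on_def)
      moreover have "degree (\<Sum>i\<le>m. smult (poly q (real i)) (l i)) \<le> m"
        by (intro degree_sum_le) (auto intro: order.trans [OF degree_smult_le] l_deg)
      ultimately show "card (real ` {..m}) > degree q"
        "card (real ` {..m}) > degree (\<Sum>i\<le>m. smult (poly q (real i)) (l i))"
        using q_deg by auto
    next
      fix x assume "x \<in> real ` {..m}"
      then obtain j where j: "j \<le> m" "x = real j" by auto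
      have "poly (\<Sum>i\<le>m. smult (poly q (real i)) (l i)) x =
          (\<Sum>i\<le>m. if i = j then poly q (real i) else 0)"
        unfolding poly_sum j by (rule sum.cong) (use j in \<open>simp_all add: l_eval\<close>)
      then show "poly q x = poly (\<Sum>i\<le>m. smult (poly q (real i)) (l i)) x"
        using j by simp
    qed
    obtain P where P: "pderiv P = p" using poly_antiderivative_exists by blast
    define Q where "Q = pcompose P [:a, d:]"
    define R where "R = smult d (\<Sum>i\<le>m. smult (poly q (real i)) (M i))"
    have "pderiv Q = smult d q"
      unfolding Q_def q_def by (simp add: pderiv_pcompose P pderiv_pCons)
    moreover have "pderiv R = smult d q"
      unfolding R_def by (subst (2) q) (simp add: pderiv_smult higher_pderiv_sum [of 1, simplified] M)
    ultimately have "poly Q (real m) - poly Q 0 = poly R (real m) - poly R 0"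
      by (intro pderiv_eq_imp_diff_eq) simp
    also have "\<dots> = d * (\<Sum>i\<le>m. poly q (real i) * (poly (M i) (real m) - poly (M i) 0))"
      unfolding R_def by (simp add: poly_sum right_diff_distrib sum_subtractf)
    also have "\<dots> = (b - a) * (\<Sum>i\<le>m. w i * poly q (real i))"
      unfolding d_def w_def by (simp add: sum_distrib_left field_simps)
    finally have "poly Q (real m) - poly Q 0 = (b - a) * (\<Sum>i\<le>m. w i * poly q (real i))" .
    moreover have "poly Q (real m) = poly P b" "poly Q 0 = poly P a"
      using m unfolding Q_def d_def by (auto simp: poly_pcompose)
    moreover have "(LBINT t=ereal a..ereal b. poly p t) = poly P b - poly P a"
      using LBINT_pderiv [of a b P] P by simp
    ultimately show "(LBINT t=ereal a..ereal b. poly p t) =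
        (b - a) * (\<Sum>i\<le>m. w i * poly p (a + real i * ((b - a) / real m)))"
      unfolding q_def d_def by (simp add: poly_pcompose)
  qed
  ultimately show ?thesis by blast
qed

lemma common_denominator:
  fixes w :: "nat \<Rightarrow> real"
  assumes "\<forall>i\<le>m. w i \<in> \<rat>"
  shows "\<exists>d::nat. d > 0 \<and> (\<forall>i\<le>m. real d * w i \<in> \<int>)"
proof -
  have "\<exists>d::nat. d > 0 \<and> real d * w i \<in> \<int>" if i: "i \<le> m" for i
  proof -
    from assms i have "w i \<in> \<rat>" by blast
    then obtain a b :: int where "b > 0" "w i = of_int a / of_int b"
      by (rule Rats_cases') auto
    then show ?thesis by (intro exI [of _ "nat b"]) auto
  qed
  then obtain d :: "nat \<Rightarrow> nat" where d: "\<And>i. i \<le> m \<Longrightarrow> d i > 0 \<and> real (d i) * w i \<in> \<int>"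
    by metis
  have "real (\<Prod>j\<le>m. d j) * w i \<in> \<int>" if i: "i \<le> m" for i
  proof -
    have "(\<Prod>j\<le>m. d j) = d i * (\<Prod>j\<in>{..m} - {i}. d j)"
      using i by (subst prod.remove [of _ i]) auto
    then have "real (\<Prod>j\<le>m. d j) * w i = (real (d i) * w i) * real (\<Prod>j\<in>{..m} - {i}. d j)"
      by simp
    also have "\<dots> \<in> \<int>" by (rule Ints_mult) (use d [OF i] in auto)
    finally show ?thesis .
  qed
  moreover have "(\<Prod>j\<le>m. d j) > 0" using d by (intro prod_pos) auto
  ultimately show ?thesis by blast
qed

lemma newton_cotes_weights_exist:
  assumes "m \<ge> 1"
  shows "\<exists>A. newton_cotes_weights m A"
proof -
  obtain w where w: "closed_newton_cotes_rule m w" "\<forall>i\<le>m. w i \<in> \<rat>"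
    using closed_newton_cotes_rule_exists [OF assms] by blast
  have "pderiv [:0, 1::real:] = [:1:]" by (simp add: pderiv_pCons)
  then have "(LBINT t=ereal 0..ereal 1. poly [:1::real:] t) = poly [:0, 1:] 1 - poly [:0, 1:] 0"
    by (metis LBINT_pderiv)
  moreover have "(LBINT t=ereal 0..ereal 1. poly [:1::real:] t) =
      (1 - 0) * (\<Sum>i\<le>m. w i * poly [:1:] (0 + real i * ((1 - 0) / real m)))"
    by (rule w(1) [unfolded closed_newton_cotes_rule_def, rule_format]) simp
  ultimately have "poly [:0, 1::real:] 1 - poly [:0, 1:] 0 =
      (1 - 0) * (\<Sum>i\<le>m. w i * poly [:1:] (0 + real i * ((1 - 0) / real m)))"
    by (rule trans [OF sym])
  then have w_sum: "(\<Sum>i\<le>m. w i) = 1" by simp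
  define c where "c = (LEAST d::nat. d > 0 \<and> (\<forall>i\<le>m. real d * w i \<in> \<int>))"
  have c: "c > 0" "\<And>i. i \<le> m \<Longrightarrow> real c * w i \<in> \<int>"
    using LeastI_ex [OF common_denominator [OF w(2)]] unfolding c_def by auto
  have c_least: "c \<le> d" if "d > 0" "\<forall>i\<le>m. real d * w i \<in> \<int>" for d
    unfolding c_def by (rule Least_le) (use that in auto)
  define A where "A i = \<lfloor>real c * w i\<rfloor>" for i
  have A: "real_of_int (A i) = real c * w i" if "i \<le> m" for i
    using c(2) [OF that] unfolding A_def by (auto elim: Ints_cases)
  have "real_of_int (\<Sum>i\<le>m. A i) = real c * (\<Sum>i\<le>m. w i)"
    unfolding of_int_sum sum_distrib_left by (rule sum.cong) (auto simp: A)
  then have A_sum: "(\<Sum>i\<le>m. A i) = int c"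
    using w_sum by (metis mult.right_neutral of_int_eq_iff of_int_of_nat_eq)
  have Aw: "real_of_int (A i) / real c = w i" if "i \<le> m" for i
    using A [OF that] c(1) by simp
  have "(\<Sum>i\<le>m. real_of_int (A i) / real c * g i) = (\<Sum>i\<le>m. w i * g i)" for g
    by (rule sum.cong) (simp_all only: Aw atMost_iff)
  then have "closed_newton_cotes_rule m (\<lambda>i. real_of_int (A i) / real c)"
    using w(1) unfolding closed_newton_cotes_rule_def by (simp only:)
  moreover have "int c \<le> d"
    if "d > 0" "\<forall>i\<le>m. real_of_int d * (real_of_int (A i) / real c) \<in> \<int>" for d
    using c_least [of "nat d"] that by (auto simp: Aw)
  ultimately have "newton_cotes_weights m A"
    unfolding newton_cotes_weights_def Let_def A_sum using c(1) by auto
  then show ?thesis by blast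
qed
primrec newton_cotes_iter ::
    "(nat \<Rightarrow> nat \<Rightarrow> int) \<Rightarrow> (real \<Rightarrow> real) \<Rightarrow> nat \<Rightarrow> real \<Rightarrow> real" where
  "newton_cotes_iter A f 0 x = x - f x / deriv f x"
| "newton_cotes_iter A f (Suc m) x =
     (let h = (newton_cotes_iter A f m x - x) / real (Suc m);
          B = (\<Sum>i\<le>Suc m. real_of_int (A (Suc m) i) * deriv f (x + real i * h));
          c = real_of_int (\<Sum>i\<le>Suc m. A (Suc m) i)
      in x - c * (f x / B))"

definition continuously_differentiable_near :: "nat \<Rightarrow> (real \<Rightarrow> real) \<Rightarrow> real \<Rightarrow> bool" where
  "continuously_differentiable_near k f z \<longleftrightarrow>
     (\<exists>U. open U \<and> z \<in> U \<and>
        (\<forall>j<k. \<forall>x\<in>U. (deriv ^^ j) f differentiable (at x)) \<and>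
        (\<forall>j\<le>k. continuous_on U ((deriv ^^ j) f)))"

text \<open>
  \<open>deriv\<close> is total, so the existence of the derivatives is stated explicitly.  For
  differentiability of order \<open>k\<close> at \<open>z\<close>, the derivatives of order less than \<open>k\<close> have to exist
  near \<open>z\<close> and the one of order \<open>k\<close> at \<open>z\<close>.
\<close>

definition times_differentiable_at :: "nat \<Rightarrow> (real \<Rightarrow> real) \<Rightarrow> real \<Rightarrow> bool" where
  "times_differentiable_at k t z \<longleftrightarrow>
     (\<forall>j. Suc j < k \<longrightarrow> (\<forall>\<^sub>F x in nhds z. (deriv ^^ j) t differentiable (at x))) \<and>
     (\<forall>j. Suc j = k \<longrightarrow> (deriv ^^ j) t differentiable (at z))"

definition convergence_order_at_least :: "nat \<Rightarrow> (real \<Rightarrow> real) \<Rightarrow> real \<Rightarrow> bool" where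
  "convergence_order_at_least p t z \<longleftrightarrow>
     t z = z \<and> times_differentiable_at (p - 1) t z \<and>
     (\<forall>j\<in>{1..p - 1}. (deriv ^^ j) t z = 0)"

end

theory Submission
  imports Defs "HOL-Library.Landau_Symbols"
begin

text \<open>
  Write \<open>e = x - z\<close> and \<open>y = t\<^sub>m\<^sub>-\<^sub>1(x)\<close>, and suppose \<open>y - z = O(e\<^sup>m\<^sup>+\<^sup>1)\<close>.  Since the rule integrates
  the Taylor polynomial of \<open>f'\<close> of degree \<open>m\<close> exactly, \<open>(y - x) B\<^sub>m(x) / c\<^sub>m\<close> is
  \<open>f(y) - f(x) + O(e\<^sup>m\<^sup>+\<^sup>2)\<close>.  As \<open>B\<^sub>m(x) / c\<^sub>m = f'(z) + O(e)\<close> and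
  \<open>f(y) = f'(z) (y - z) + O((y - z)\<^sup>2)\<close>, this becomes \<open>e B\<^sub>m(x) / c\<^sub>m = f(x) + O(e\<^sup>m\<^sup>+\<^sup>2)\<close>, that is,
  \<open>t\<^sub>m(x) - z = O(e\<^sup>m\<^sup>+\<^sup>2)\<close>.  Newton's function is the case \<open>m = 0\<close> of this step, with the
  one-point rule and \<open>y = z\<close>.  Since \<open>t\<^sub>n\<close> is \<open>n + 1\<close> times differentiable near \<open>z\<close>, the
  estimate makes its derivatives at \<open>z\<close> vanish.
\<close>

section \<open>Repeated differentiability near a point\<close>

text \<open>The recursion passes to \<open>deriv f\<close>, so an induction on the order can follow
  the rules of differentiation. Each order is required only eventually, hence the neighborhood may
  shrink from one order to the next.\<close>

primrec times_differentiable_near :: "nat \<Rightarrow> (real \<Rightarrow> real) \<Rightarrow> real \<Rightarrow> bool" where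
  "times_differentiable_near 0 f z \<longleftrightarrow> True"
| "times_differentiable_near (Suc k) f z \<longleftrightarrow>
     (\<forall>\<^sub>F x in nhds z. f differentiable (at x)) \<and> times_differentiable_near k (deriv f) z"

text \<open>Functions that agree near \<open>z\<close> also agree near every point close to
  \<open>z\<close>, and a derivative depends only on the values near its point.\<close>

lemma eventually_nhds_eq_imp_DERIV_iff:
  fixes f g :: "real \<Rightarrow> real"
  assumes "\<forall>\<^sub>F x in nhds z. f x = g x"
  shows "\<forall>\<^sub>F x in nhds z. \<forall>D. DERIV f x :> D \<longleftrightarrow> DERIV g x :> D"
  using assms unfolding eventually_eventually [of "\<lambda>x. f x = g x" z, symmetric]
  by (rule eventually_mono) (simp add: DERIV_cong_ev)

lemma eventually_DERIV_imp_deriv_eq: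
  fixes f g :: "real \<Rightarrow> real"
  assumes "\<forall>\<^sub>F x in nhds z. DERIV f x :> g x"
  shows "\<forall>\<^sub>F x in nhds z. deriv f x = g x"
  using assms by (rule eventually_mono) (rule DERIV_imp_deriv)

lemma times_differentiable_near_cong:
  assumes "\<forall>\<^sub>F x in nhds z. f x = g x"
  shows "times_differentiable_near k f z \<longleftrightarrow> times_differentiable_near k g z"
  using assms
proof (induction k arbitrary: f g)
  case (Suc k)
  note ev = eventually_nhds_eq_imp_DERIV_iff [OF Suc.prems]
  have "\<forall>\<^sub>F x in nhds z. deriv f x = deriv g x"
    using ev by (rule eventually_mono) (simp add: deriv_def)
  moreover have "(\<forall>\<^sub>F x in nhds z. f differentiable (at x)) \<longleftrightarrow>
      (\<forall>\<^sub>F x in nhds z. g differentiable (at x))"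
    by (rule eventually_cong [OF ev]) (simp add: real_differentiable_def)
  ultimately show ?case using Suc.IH [of "deriv f" "deriv g"] by simp
qed simp

text \<open>Serves to supply an explicit formula \<open>g\<close> for the derivative. Away from
  \<open>z\<close>, \<open>deriv f\<close> may differ from \<open>g\<close>, so the property is
  transferred by agreement near \<open>z\<close>.\<close>

lemma times_differentiable_near_SucI:
  assumes "\<forall>\<^sub>F x in nhds z. DERIV f x :> g x" "times_differentiable_near k g z"
  shows "times_differentiable_near (Suc k) f z"
  using assms times_differentiable_near_cong [OF eventually_DERIV_imp_deriv_eq [OF assms(1)]]
  by (auto elim!: eventually_mono simp: real_differentiable_def)

lemma times_differentiable_near_SucD:
  assumes "times_differentiable_near (Suc k) f z"
  shows "\<forall>\<^sub>F x in nhds z. DERIV f x :> deriv f x" "times_differentiable_near k (deriv f) z"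
  using assms by (auto simp: DERIV_deriv_iff_real_differentiable)

lemma times_differentiable_near_mono:
  assumes "times_differentiable_near k f z" "j \<le> k"
  shows "times_differentiable_near j f z"
  using assms
proof (induction k arbitrary: f j)
  case (Suc k)
  then show ?case by (cases j) auto
qed simp

lemma times_differentiable_near_iff:
  "times_differentiable_near k f z \<longleftrightarrow>
     (\<forall>j<k. \<forall>\<^sub>F x in nhds z. (deriv ^^ j) f differentiable (at x))"
  by (induction k arbitrary: f) (simp_all add: All_less_Suc2 funpow_swap1)

lemma times_differentiable_near_const: "times_differentiable_near k (\<lambda>x. c) z"
proof (induction k arbitrary: c)
  case (Suc k)
  show ?case by (rule times_differentiable_near_SucI [OF _ Suc [of 0]]) simp
qed simp

lemma times_differentiable_near_ident: "times_differentiable_near k (\<lambda>x. x) z"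
proof (cases k)
  case (Suc j)
  then show ?thesis
    using times_differentiable_near_SucI [OF _ times_differentiable_near_const [of j 1 z], of "\<lambda>x. x"]
    by simp
qed simp

lemma times_differentiable_near_add:
  assumes "times_differentiable_near k f z" "times_differentiable_near k g z"
  shows "times_differentiable_near k (\<lambda>x. f x + g x) z"
  using assms
proof (induction k arbitrary: f g)
  case (Suc k)
  note f = times_differentiable_near_SucD [OF Suc.prems(1)]
  note g = times_differentiable_near_SucD [OF Suc.prems(2)]
  have "\<forall>\<^sub>F x in nhds z. DERIV (\<lambda>x. f x + g x) x :> deriv f x + deriv g x"
    using f(1) g(1) by eventually_elim (rule DERIV_add)
  then show ?case by (rule times_differentiable_near_SucI) (rule Suc.IH [OF f(2) g(2)])
qed simp

lemma times_differentiable_near_mult: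
  assumes "times_differentiable_near k f z" "times_differentiable_near k g z"
  shows "times_differentiable_near k (\<lambda>x. f x * g x) z"
  using assms
proof (induction k arbitrary: f g)
  case (Suc k)
  note f = times_differentiable_near_SucD [OF Suc.prems(1)]
  note g = times_differentiable_near_SucD [OF Suc.prems(2)]
  note fg = Suc.prems [THEN times_differentiable_near_mono [of "Suc k" _ z k]]
  have "\<forall>\<^sub>F x in nhds z. DERIV (\<lambda>x. f x * g x) x :> deriv f x * g x + deriv g x * f x"
    using f(1) g(1) by eventually_elim (rule DERIV_mult)
  then show ?case
    by (rule times_differentiable_near_SucI)
      (intro times_differentiable_near_add Suc.IH f g fg le_SucI order.refl)
qed simp

lemma times_differentiable_near_diff:
  assumes "times_differentiable_near k f z" "times_differentiable_near k g z"
  shows "times_differentiable_near k (\<lambda>x. f x - g x) z"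
  using times_differentiable_near_add [OF assms(1)
      times_differentiable_near_mult [OF times_differentiable_near_const [of k "-1"] assms(2)]]
  by simp

lemma times_differentiable_near_sum:
  assumes "\<And>i. i \<in> I \<Longrightarrow> times_differentiable_near k (f i) z"
  shows "times_differentiable_near k (\<lambda>x. \<Sum>i\<in>I. f i x) z"
  using assms
  by (induction I rule: infinite_finite_induct)
    (auto intro: times_differentiable_near_const times_differentiable_near_add)

lemma times_differentiable_near_Suc_imp_isCont:
  assumes "times_differentiable_near (Suc k) f z"
  shows "isCont f z"
  using eventually_nhds_x_imp_x [OF times_differentiable_near_SucD(1) [OF assms]]
  by (rule DERIV_isCont)

text \<open>By the chain rule the derivative is a product whose first factor is again a composition
  with the same \<open>g\<close>, so the induction varies \<open>f\<close> only. Continuity of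
  \<open>g\<close> at \<open>z\<close> carries what holds near \<open>g z\<close> back to a
  neighborhood of \<open>z\<close>.\<close>

lemma times_differentiable_near_compose:
  assumes "times_differentiable_near k f (g z)" "times_differentiable_near k g z"
  shows "times_differentiable_near k (\<lambda>x. f (g x)) z"
  using assms
proof (induction k arbitrary: f)
  case (Suc k)
  note f = times_differentiable_near_SucD [OF Suc.prems(1)]
  note g = times_differentiable_near_SucD [OF Suc.prems(2)]
  have "isCont g z" by (rule times_differentiable_near_Suc_imp_isCont [OF Suc.prems(2)])
  then have "filterlim g (nhds (g z)) (nhds z)" by (simp add: isCont_def tendsto_at_iff_tendsto_nhds)
  then have "\<forall>\<^sub>F x in nhds z. DERIV f (g x) :> deriv f (g x)"
    using f(1) by (rule eventually_compose_filterlim [rotated])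
  then have "\<forall>\<^sub>F x in nhds z. DERIV (\<lambda>x. f (g x)) x :> deriv f (g x) * deriv g x"
    using g(1) by eventually_elim (rule DERIV_chain2)
  moreover have "times_differentiable_near k (\<lambda>x. deriv f (g x)) z"
    using Suc.IH [OF f(2)] times_differentiable_near_mono [OF Suc.prems(2)] by simp
  ultimately show ?case
    by (rule times_differentiable_near_SucI [OF _ times_differentiable_near_mult [OF _ g(2)]])
qed simp

lemma times_differentiable_near_inverse:
  assumes "times_differentiable_near k f z" "f z \<noteq> 0"
  shows "times_differentiable_near k (\<lambda>x. inverse (f x)) z"
  using assms
proof (induction k)
  case (Suc k)
  note f = times_differentiable_near_SucD [OF Suc.prems(1)]
  have inv: "times_differentiable_near k (\<lambda>x. inverse (f x)) z"
    using Suc times_differentiable_near_mono [OF Suc.prems(1), of k] by simp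
  have "isCont f z" by (rule times_differentiable_near_Suc_imp_isCont [OF Suc.prems(1)])
  then have "filterlim f (nhds (f z)) (nhds z)" by (simp add: isCont_def tendsto_at_iff_tendsto_nhds)
  then have "\<forall>\<^sub>F x in nhds z. f x \<noteq> 0"
    using Suc.prems(2) by (rule tendsto_imp_eventually_ne)
  \<comment> \<open>The derivative is written as a product containing \<open>inverse (f x)\<close>
    itself, which is covered by the induction hypothesis of order \<open>k\<close>.\<close>
  then have "\<forall>\<^sub>F x in nhds z.
      DERIV (\<lambda>x. inverse (f x)) x :> -1 * (inverse (f x) * deriv f x * inverse (f x))"
    using f(1) by eventually_elim (use DERIV_inverse' in fastforce)
  then show ?case
    by (rule times_differentiable_near_SucI)
      (intro times_differentiable_near_mult times_differentiable_near_const inv f)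
qed simp

lemma times_differentiable_near_divide:
  assumes "times_differentiable_near k f z" "times_differentiable_near k g z" "g z \<noteq> 0"
  shows "times_differentiable_near k (\<lambda>x. f x / g x) z"
  unfolding divide_inverse
  by (intro times_differentiable_near_mult times_differentiable_near_inverse assms)

section \<open>Landau estimates at a point\<close>

lemma bigo_power_nhds_mono:
  fixes z :: real
  assumes "j \<le> k"
  shows "(\<lambda>x. (x - z) ^ k) \<in> O[nhds z](\<lambda>x. (x - z) ^ j)"
proof (rule landau_o.bigI [of 1])
  have "\<forall>\<^sub>F x in nhds z. dist x z < 1" by (auto simp: eventually_nhds_metric intro: exI [of _ 1])
  then show "\<forall>\<^sub>F x in nhds z. norm ((x - z) ^ k) \<le> 1 * norm ((x - z) ^ j)"
    by eventually_elim (use assms in \<open>auto simp: power_abs dist_real_def intro: power_decreasing\<close>)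
qed simp

text \<open>The filter \<open>nhds z\<close>, unlike \<open>at z\<close>, includes the point
  \<open>z\<close>, so the estimate holds there too, with right-hand side zero.\<close>

lemma bigo_nhds_imp_eq_0:
  fixes g :: "real \<Rightarrow> real"
  assumes "g \<in> O[nhds z](\<lambda>x. (x - z) ^ k)" "k > 0"
  shows "g z = 0"
  using assms by (auto elim!: landau_o.bigE dest!: eventually_nhds_x_imp_x simp: power_0_left)

lemma bigo_nhds_imp_tendsto:
  fixes g :: "real \<Rightarrow> real"
  assumes "(\<lambda>x. g x - c) \<in> O[nhds z](\<lambda>x. x - z)"
  shows "(g \<longlongrightarrow> c) (nhds z)"
proof -
  obtain C where "\<forall>\<^sub>F x in nhds z. norm (g x - c) \<le> C * norm (x - z)"
    using assms by (elim landau_o.bigE)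
  moreover have "((\<lambda>x. C * norm (x - z)) \<longlongrightarrow> C * norm (z - z)) (nhds z)"
    by (intro tendsto_intros filterlim_ident)
  then have "((\<lambda>x. C * norm (x - z)) \<longlongrightarrow> 0) (nhds z)" by simp
  ultimately have "((\<lambda>x. g x - c) \<longlongrightarrow> 0) (nhds z)" by (rule Lim_null_comparison)
  then show ?thesis by (rule LIM_zero_cancel)
qed

text \<open>Mean value inequality on the segment from \<open>z\<close> to \<open>x\<close>: there
  the derivative is at most C |x - z|^k, and the length of the segment gives one more factor |x -
  z|.\<close>

lemma bigo_antiderivative:
  fixes g :: "real \<Rightarrow> real"
  assumes deriv: "\<forall>\<^sub>F x in nhds z. DERIV g x :> g' x"
    and "g' \<in> O[nhds z](\<lambda>x. (x - z) ^ k)" and "g z = 0"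
  shows "g \<in> O[nhds z](\<lambda>x. (x - z) ^ Suc k)"
proof -
  obtain C where "\<forall>\<^sub>F x in nhds z. norm (g' x) \<le> C * norm ((x - z) ^ k)" and C: "C > 0"
    using assms(2) by (elim landau_o.bigE)
  with deriv have "\<forall>\<^sub>F x in nhds z. DERIV g x :> g' x \<and> norm (g' x) \<le> C * norm ((x - z) ^ k)"
    by (simp add: eventually_conj_iff)
  then obtain d where d: "d > 0"
    "\<And>x. dist x z < d \<Longrightarrow> DERIV g x :> g' x \<and> \<bar>g' x\<bar> \<le> C * \<bar>x - z\<bar> ^ k"
    unfolding eventually_nhds_metric by (auto simp: power_abs)
  have "norm (g x) \<le> C * norm ((x - z) ^ Suc k)" if x: "dist x z < d" for x
  proof -
    have "norm (g x - g z) \<le> C * \<bar>x - z\<bar> ^ k * norm (x - z)"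
    proof (rule field_differentiable_bound)
      fix t assume t: "t \<in> closed_segment z x"
      then have tz: "\<bar>t - z\<bar> \<le> \<bar>x - z\<bar>"
        by (auto simp: closed_segment_eq_real_ivl split: if_splits)
      then have td: "dist t z < d" using x by (simp add: dist_real_def)
      then show "(g has_field_derivative g' t) (at t within closed_segment z x)"
        using d(2) has_field_derivative_at_within by blast
      have "\<bar>g' t\<bar> \<le> C * \<bar>t - z\<bar> ^ k" using d(2) td by blast
      also have "\<dots> \<le> C * \<bar>x - z\<bar> ^ k" using tz C by (intro mult_left_mono power_mono) auto
      finally show "norm (g' t) \<le> C * \<bar>x - z\<bar> ^ k" by simp
    qed auto
    then show ?thesis using assms(3) by (simp add: power_abs abs_mult mult_ac)
  qed
  then show ?thesis
    using d(1) by (intro landau_o.bigI [of C] C) (auto simp: eventually_nhds_metric)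
qed

text \<open>The difference quotient converges, hence is bounded near \<open>z\<close>. At
  \<open>z\<close> itself both sides vanish, which extends the estimate from \<open>at z\<close> to
  \<open>nhds z\<close>.\<close>

lemma DERIV_imp_bigo:
  fixes g :: "real \<Rightarrow> real"
  assumes "DERIV g z :> D"
  shows "(\<lambda>x. g x - g z) \<in> O[nhds z](\<lambda>x. x - z)"
proof -
  have "((\<lambda>x. (g x - g z) / (x - z)) \<longlongrightarrow> D) (at z)"
    using assms by (simp add: has_field_derivative_iff)
  then have "(\<lambda>x. g x - g z) \<in> O[at z](\<lambda>x. x - z)"
    by (rule bigoI_tendsto) (simp add: eventually_at_filter)
  then show ?thesis
    by (elim landau_o.bigE, intro landau_o.bigI) (auto simp: eventually_at_filter elim: eventually_mono)
qed

section \<open>Taylor polynomials and vanishing derivatives\<close>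

text \<open>Induction by integration: an antiderivative of the polynomial for
  \<open>deriv g\<close>, with its constant term chosen to match \<open>g z\<close>, approximates
  \<open>g\<close> to one order more.\<close>

lemma taylor_poly_exists:
  assumes "times_differentiable_near (Suc k) g z"
  shows "\<exists>P. degree P \<le> k \<and> (\<lambda>x. g x - poly P x) \<in> O[nhds z](\<lambda>x. (x - z) ^ Suc k)"
  using assms
proof (induction k arbitrary: g)
  case 0
  have "DERIV g z :> deriv g z"
    using times_differentiable_near_SucD(1) [OF 0] by (rule eventually_nhds_x_imp_x)
  from DERIV_imp_bigo [OF this] show ?case by (intro exI [of _ "[:g z:]"]) simp
next
  case (Suc k)
  note g = times_differentiable_near_SucD [OF Suc.prems]
  obtain P where P: "degree P \<le> k"
      "(\<lambda>x. deriv g x - poly P x) \<in> O[nhds z](\<lambda>x. (x - z) ^ Suc k)"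
    using Suc.IH [OF g(2)] by blast
  obtain Q where Q: "pderiv Q = P" using poly_antiderivative_exists by blast
  define Q' where "Q' = Q + [:g z - poly Q z:]"
  have Q': "pderiv Q' = P" by (simp add: Q'_def Q pderiv_add pderiv_pCons)
  have "(\<lambda>x. g x - poly Q' x) \<in> O[nhds z](\<lambda>x. (x - z) ^ Suc (Suc k))"
  proof (rule bigo_antiderivative [OF _ P(2)])
    show "\<forall>\<^sub>F x in nhds z. DERIV (\<lambda>x. g x - poly Q' x) x :> deriv g x - poly P x"
      using g(1) by eventually_elim (metis DERIV_diff poly_DERIV Q')
  qed (simp add: Q'_def)
  moreover have "degree Q' \<le> Suc k"
    using P(1) degree_pderiv [of Q'] Q' by simp
  ultimately show ?case by blast
qed

text \<open>L'Hopital's rule lowers the exponent by one and replaces \<open>g\<close> by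
  \<open>deriv g\<close>; the case of exponent one is the definition of the derivative at
  \<open>z\<close>.\<close>

lemma tendsto_divide_power:
  assumes "times_differentiable_near (Suc k) g z" "\<And>i. i \<le> k \<Longrightarrow> (deriv ^^ i) g z = 0"
  shows "((\<lambda>x. g x / (x - z) ^ Suc k) \<longlongrightarrow> (deriv ^^ Suc k) g z / fact (Suc k)) (at z)"
  using assms
proof (induction k arbitrary: g)
  case 0
  have "DERIV g z :> deriv g z"
    using times_differentiable_near_SucD(1) [OF 0(1)] by (rule eventually_nhds_x_imp_x)
  then show ?case using 0(2) [of 0] by (simp add: has_field_derivative_iff)
next
  case (Suc k)
  note g = times_differentiable_near_SucD [OF Suc.prems(1)]
  have "((\<lambda>x. deriv g x / (x - z) ^ Suc k) \<longlongrightarrow>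
      (deriv ^^ Suc k) (deriv g) z / fact (Suc k)) (at z)"
    by (rule Suc.IH [OF g(2)]) (use Suc.prems(2) [of "Suc _"] in \<open>simp add: funpow_swap1\<close>)
  then have "((\<lambda>x. deriv g x / (x - z) ^ Suc k / real (Suc (Suc k))) \<longlongrightarrow>
      (deriv ^^ Suc k) (deriv g) z / fact (Suc k) / real (Suc (Suc k))) (at z)"
    by (rule tendsto_divide) auto
  then have lim: "((\<lambda>x. deriv g x / (real (Suc (Suc k)) * (x - z) ^ Suc k)) \<longlongrightarrow>
      (deriv ^^ Suc (Suc k)) g z / fact (Suc (Suc k))) (at z)"
    by (simp add: funpow_swap1 mult_ac del: of_nat_Suc power_Suc)
  have ne: "\<forall>\<^sub>F x in at z. x \<noteq> z" by (simp add: eventually_at_filter)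
  show ?case
  proof (rule lhopital [OF _ _ _ _ _ _ lim])
    have "isCont g z" by (rule times_differentiable_near_Suc_imp_isCont [OF Suc.prems(1)])
    then show "(g \<longlongrightarrow> 0) (at z)" using Suc.prems(2) [of 0] by (simp add: isCont_def)
    show "((\<lambda>x. (x - z) ^ Suc (Suc k)) \<longlongrightarrow> 0) (at z)"
      by (rule tendsto_eq_intros refl)+ simp
    show "\<forall>\<^sub>F x in at z. (x - z) ^ Suc (Suc k) \<noteq> 0"
      using ne by eventually_elim simp
    show "\<forall>\<^sub>F x in at z. real (Suc (Suc k)) * (x - z) ^ Suc k \<noteq> 0"
      using ne by eventually_elim (simp del: of_nat_Suc)
    show "\<forall>\<^sub>F x in at z. DERIV g x :> deriv g x"
      using g(1) by (simp add: eventually_at_filter eventually_mono)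
    show "\<forall>\<^sub>F x in at z. ((\<lambda>x. (x - z) ^ Suc (Suc k)) has_real_derivative
        real (Suc (Suc k)) * (x - z) ^ Suc k) (at x)"
      by (rule always_eventually) (auto intro!: derivative_eq_intros simp del: power_Suc of_nat_Suc)
  qed
qed

text \<open>Once the derivatives of order below \<open>j\<close> vanish, g(x) / (x - z)^j tends to
  the \<open>j\<close>-th derivative divided by j!. The estimate forces this limit to be 0, since
  the exponent k + 1 - j is positive.\<close>

lemma bigo_imp_higher_deriv_eq_0:
  assumes "times_differentiable_near k g z" "g \<in> O[nhds z](\<lambda>x. (x - z) ^ Suc k)" "j \<le> k"
  shows "(deriv ^^ j) g z = 0"
  using assms(3)
proof (induction j rule: less_induct)
  case (less j)
  show ?case
  proof (cases j)
    case 0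
    then show ?thesis using bigo_nhds_imp_eq_0 [OF assms(2)] by simp
  next
    case (Suc i)
    have "times_differentiable_near (Suc i) g z"
      using times_differentiable_near_mono [OF assms(1) less.prems] Suc by simp
    then have lim: "((\<lambda>x. g x / (x - z) ^ j) \<longlongrightarrow> (deriv ^^ j) g z / fact j) (at z)"
      using tendsto_divide_power [of i g z] less Suc by simp
    obtain C where "\<forall>\<^sub>F x in nhds z. norm (g x) \<le> C * norm ((x - z) ^ Suc k)"
      using assms(2) by (elim landau_o.bigE)
    then have "\<forall>\<^sub>F x in at z. norm (g x / (x - z) ^ j) \<le> C * \<bar>x - z\<bar> ^ (Suc k - j)"
      unfolding eventually_at_filter
    proof eventually_elim
      case (elim x)
      have "\<bar>x - z\<bar> ^ Suc k = \<bar>x - z\<bar> ^ (Suc k - j) * \<bar>x - z\<bar> ^ j"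
        using less.prems by (simp flip: power_add)
      with elim show ?case
        by (simp add: power_abs pos_divide_le_eq mult.assoc del: power_Suc)
    qed
    moreover have "((\<lambda>x. C * \<bar>x - z\<bar> ^ (Suc k - j)) \<longlongrightarrow> 0) (at z)"
      by (rule tendsto_eq_intros refl)+ (use less.prems in simp)
    ultimately have "((\<lambda>x. g x / (x - z) ^ j) \<longlongrightarrow> 0) (at z)"
      by (rule Lim_null_comparison)
    from LIM_unique [OF lim this] show ?thesis by simp
  qed
qed

section \<open>Exactness of the quadrature rule\<close>

text \<open>The exactness condition freed of integrals by the fundamental theorem of
  calculus.\<close>

lemma closed_newton_cotes_rule_poly:
  assumes "closed_newton_cotes_rule m w" "degree (pderiv Q) \<le> m"
  shows "poly Q b - poly Q a =
    (b - a) * (\<Sum>i\<le>m. w i * poly (pderiv Q) (a + real i * ((b - a) / real m)))"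
  using assms LBINT_pderiv [of a b Q] unfolding closed_newton_cotes_rule_def by simp

lemma closed_newton_cotes_rule_sum:
  assumes "closed_newton_cotes_rule m w"
  shows "(\<Sum>i\<le>m. w i) = 1"
  \<comment> \<open>The constant 1 is integrated over the unit interval.\<close>
  using closed_newton_cotes_rule_poly [OF assms, of "[:0, 1:]" 1 0] by (simp add: pderiv_pCons)

text \<open>The node spacing is \<open>(b - a) / 0 = 0\<close> here, so the single node is \<open>a\<close>.\<close>

lemma closed_newton_cotes_rule_0: "closed_newton_cotes_rule 0 (\<lambda>_. 1)"
  unfolding closed_newton_cotes_rule_def
proof (intro allI impI)
  fix a b :: real and p :: "real poly"
  assume "degree p \<le> 0"
  then obtain c where c: "p = [:c:]" by (auto elim: degree_eq_zeroE)
  then have "pderiv [:0, c:] = p" by (simp add: pderiv_pCons)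
  then show "(LBINT t=ereal a..ereal b. poly p t) =
      (b - a) * (\<Sum>i\<le>0. 1 * poly p (a + real i * ((b - a) / real 0)))"
    using LBINT_pderiv [of a b "[:0, c:]"] c by (simp add: algebra_simps)
qed

section \<open>The gain of one order per step\<close>

text \<open>Stated for any \<open>y\<close> of the required order and for weights of sum 1, so that
  Newton's function and the recursion are both instances.\<close>

lemma newton_cotes_step:
  fixes f y w B :: "_ \<Rightarrow> real" and m :: nat
  defines "B \<equiv> \<lambda>x. \<Sum>i\<le>m. w i * deriv f (x + real i * ((y x - x) / real m))"
  assumes rule: "closed_newton_cotes_rule m w"
    and f: "times_differentiable_near (Suc (Suc m)) f z" "f z = 0" "deriv f z \<noteq> 0"
    and y: "(\<lambda>x. y x - z) \<in> O[nhds z](\<lambda>x. (x - z) ^ Suc m)"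
  shows "(\<lambda>x. x - f x / B x - z) \<in> O[nhds z](\<lambda>x. (x - z) ^ Suc (Suc m))"
proof -
  note f' = times_differentiable_near_SucD [OF f(1)]
  define u where "u i x = x + real i * ((y x - x) / real m)" for i x
  have cmult: "(\<lambda>x. c * g x) \<in> O[nhds z](h)" if "g \<in> O[nhds z](h)" for c :: real and g h
    using that by (cases "c = 0") auto
  have id: "(\<lambda>x. x - z) \<in> O[nhds z](\<lambda>x. x - z)" by simp
  have y1: "(\<lambda>x. y x - z) \<in> O[nhds z](\<lambda>x. x - z)"
    using landau_o.big_trans [OF y bigo_power_nhds_mono [of 1 "Suc m" z]] by simp
  have yx: "(\<lambda>x. y x - x) \<in> O[nhds z](\<lambda>x. x - z)"
    using sum_in_bigo(2) [OF y1 id] by simp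
  have u: "(\<lambda>x. u i x - z) \<in> O[nhds z](\<lambda>x. x - z)" for i
  proof -
    have "(\<lambda>x. (x - z) + real i / real m * (y x - x)) \<in> O[nhds z](\<lambda>x. x - z)"
      by (intro sum_in_bigo(1) id cmult yx)
    then show ?thesis by (simp add: u_def algebra_simps)
  qed
  have compose: "(\<lambda>x. g (v x)) \<in> O[nhds z](\<lambda>x. (x - z) ^ k)"
    if "g \<in> O[nhds z](\<lambda>x. (x - z) ^ k)" "(\<lambda>x. v x - z) \<in> O[nhds z](\<lambda>x. x - z)"
    for g v :: "real \<Rightarrow> real" and k
    using landau_o.big_trans [OF landau_o.big.compose [OF that(1) bigo_nhds_imp_tendsto [OF that(2)]]
        landau_o.big_power [OF that(2)]] .
  obtain P where P: "degree P \<le> m"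
      "(\<lambda>x. deriv f x - poly P x) \<in> O[nhds z](\<lambda>x. (x - z) ^ Suc m)"
    using taylor_poly_exists [OF f'(2)] by blast
  obtain Q0 where Q0: "pderiv Q0 = P" using poly_antiderivative_exists by blast
  \<comment> \<open>The constant is chosen so that \<open>Q\<close> vanishes at \<open>z\<close>
    like \<open>f\<close>; then \<open>F\<close> is the antiderivative of the Taylor remainder of
    \<open>deriv f\<close> that vanishes at \<open>z\<close>. \<open>R\<close> is the quadrature sum
    of this remainder over the nodes \<open>u i x\<close>.\<close>
  define Q where "Q = Q0 - [:poly Q0 z:]"
  have Q: "pderiv Q = P" "poly Q z = 0" by (simp_all add: Q_def Q0 pderiv_diff pderiv_pCons)
  define F where "F x = f x - poly Q x" for x
  define R where "R x = (\<Sum>i\<le>m. w i * (deriv f (u i x) - poly P (u i x)))" for x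
  have F: "F \<in> O[nhds z](\<lambda>x. (x - z) ^ Suc (Suc m))"
  proof (rule bigo_antiderivative [OF _ P(2)])
    show "\<forall>\<^sub>F x in nhds z. DERIV F x :> deriv f x - poly P x"
      using f'(1) unfolding F_def by eventually_elim (metis DERIV_diff poly_DERIV Q(1))
  qed (simp add: F_def Q f(2))
  have R: "R \<in> O[nhds z](\<lambda>x. (x - z) ^ Suc m)"
    unfolding R_def by (intro big_sum_in_bigo cmult compose [OF P(2) u])
  have "DERIV (deriv f) z :> deriv (deriv f) z"
    using times_differentiable_near_SucD(1) [OF f'(2)] by (rule eventually_nhds_x_imp_x)
  then have f'_bigo: "(\<lambda>x. deriv f x - deriv f z) \<in> O[nhds z](\<lambda>x. (x - z) ^ 1)"
    using DERIV_imp_bigo by simp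
  \<comment> \<open>The error of linearizing \<open>f\<close> at \<open>z\<close>, which is
    quadratic.\<close>
  define G where "G x = f x - deriv f z * (x - z)" for x
  have "G \<in> O[nhds z](\<lambda>x. (x - z) ^ Suc 1)"
  proof (rule bigo_antiderivative [OF _ f'_bigo])
    show "\<forall>\<^sub>F x in nhds z. DERIV G x :> deriv f x - deriv f z"
      using f'(1) unfolding G_def by eventually_elim (auto intro!: derivative_eq_intros)
  qed (simp add: G_def f(2))
  then have "(\<lambda>x. G (y x)) \<in> O[nhds z](\<lambda>x. (y x - z) ^ Suc 1)"
    by (rule landau_o.big.compose) (rule bigo_nhds_imp_tendsto [OF y1])
  also have "(\<lambda>x. (y x - z) ^ Suc 1) \<in> O[nhds z](\<lambda>x. ((x - z) ^ Suc m) ^ Suc 1)"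
    by (rule landau_o.big_power [OF y])
  \<comment> \<open>The exponent 2 (m + 1) is at least m + 2, with equality for m = 0.\<close>
  also have "(\<lambda>x. ((x - z) ^ Suc m) ^ Suc 1) \<in> O[nhds z](\<lambda>x. (x - z) ^ Suc (Suc m))"
    unfolding power_mult [symmetric] by (rule bigo_power_nhds_mono) simp
  finally have G: "(\<lambda>x. G (y x)) \<in> O[nhds z](\<lambda>x. (x - z) ^ Suc (Suc m))" .
  \<comment> \<open>As the weights sum to 1, B(x) - f'(z) is the weighted sum of the deviations
    f'(u) - f'(z) at the nodes u.\<close>
  have "(\<lambda>x. \<Sum>i\<le>m. w i * (deriv f (u i x) - deriv f z)) \<in> O[nhds z](\<lambda>x. (x - z) ^ 1)"
    by (intro big_sum_in_bigo cmult compose [OF f'_bigo u])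
  moreover have "(\<Sum>i\<le>m. w i * (deriv f (u i x) - deriv f z)) = B x - deriv f z" for x
    using closed_newton_cotes_rule_sum [OF rule]
    by (simp add: B_def u_def right_diff_distrib sum_subtractf flip: sum_distrib_right)
  ultimately have B: "(\<lambda>x. B x - deriv f z) \<in> O[nhds z](\<lambda>x. x - z)" by simp
  then have B_lim: "(B \<longlongrightarrow> deriv f z) (nhds z)" by (rule bigo_nhds_imp_tendsto)
  have B_inv: "(\<lambda>x. inverse (B x)) \<in> O[nhds z](\<lambda>_. 1)"
    using tendsto_inverse [OF B_lim f(3)] by (intro bigoI_tendsto) auto
  have "(\<lambda>x. (y x - z) * (B x - deriv f z)) \<in> O[nhds z](\<lambda>x. (x - z) ^ Suc m * (x - z))"
    by (rule landau_o.big.mult [OF y B])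
  moreover have "(\<lambda>x. (y x - x) * R x) \<in> O[nhds z](\<lambda>x. (x - z) * (x - z) ^ Suc m)"
    by (rule landau_o.big.mult [OF yx R])
  moreover have "(\<lambda>x. F (y x)) \<in> O[nhds z](\<lambda>x. (x - z) ^ Suc (Suc m))"
    by (rule compose [OF F y1])
  ultimately have "(\<lambda>x. (y x - z) * (B x - deriv f z) - G (y x) + F (y x) - F x - (y x - x) * R x)
      \<in> O[nhds z](\<lambda>x. (x - z) ^ Suc (Suc m))"
    using F G by (intro sum_in_bigo) (simp_all add: mult_ac)
  \<comment> \<open>Exactness for \<open>Q\<close> expresses \<open>(y x - x) * R x\<close> through
    \<open>B x\<close> and the increment of \<open>Q\<close>. With \<open>f\<close> =
    \<open>F\<close> + \<open>Q\<close> the polynomial cancels, and the linearization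
    \<open>G\<close> removes \<open>f (y x)\<close>.\<close>
  moreover have "(y x - z) * (B x - deriv f z) - G (y x) + F (y x) - F x - (y x - x) * R x =
      (x - z) * B x - f x" for x
  proof -
    have "R x = B x - (\<Sum>i\<le>m. w i * poly P (u i x))"
      by (simp add: R_def B_def u_def right_diff_distrib sum_subtractf)
    moreover have "poly Q (y x) - poly Q x = (y x - x) * (\<Sum>i\<le>m. w i * poly P (u i x))"
      using closed_newton_cotes_rule_poly [OF rule, of Q] P(1) by (simp add: Q u_def)
    ultimately have "(y x - x) * R x = (y x - x) * B x - (poly Q (y x) - poly Q x)"
      by (simp add: right_diff_distrib)
    then show ?thesis by (simp add: F_def G_def algebra_simps)
  qed
  ultimately have "(\<lambda>x. (x - z) * B x - f x) \<in> O[nhds z](\<lambda>x. (x - z) ^ Suc (Suc m))"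
    by simp
  from landau_o.big.mult [OF this B_inv]
  have "(\<lambda>x. ((x - z) * B x - f x) * inverse (B x)) \<in> O[nhds z](\<lambda>x. (x - z) ^ Suc (Suc m))"
    by simp
  moreover have "\<forall>\<^sub>F x in nhds z. ((x - z) * B x - f x) * inverse (B x) = x - f x / B x - z"
    using tendsto_imp_eventually_ne [OF B_lim f(3)] by eventually_elim (simp add: field_simps)
  ultimately show ?thesis by (simp add: landau_o.big.in_cong)
qed

section \<open>Application to the iterative functions\<close>

text \<open>The factor c is absorbed into the weights. If the integer weights sum to 0, both sides
  are \<open>x\<close>, because division by zero gives zero.\<close>

lemma newton_cotes_iter_Suc_normalized:
  "newton_cotes_iter A f (Suc m) x =
     x - f x / (\<Sum>i\<le>Suc m. real_of_int (A (Suc m) i) / real_of_int (\<Sum>i\<le>Suc m. A (Suc m) i) *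
       deriv f (x + real i * ((newton_cotes_iter A f m x - x) / real (Suc m))))"
proof -
  have "c * (a / (\<Sum>i\<in>I. w i * d i)) = a / (\<Sum>i\<in>I. w i / c * d i)"
    for a c :: real and I :: "nat set" and w d
    by (simp add: mult.commute flip: sum_divide_distrib)
  then show ?thesis by (simp only: newton_cotes_iter.simps Let_def)
qed

lemma newton_cotes_iter_bigo:
  assumes "\<And>m. m \<ge> 1 \<Longrightarrow> newton_cotes_weights m (A m)"
    and "times_differentiable_near (Suc (Suc m)) f z" "f z = 0" "deriv f z \<noteq> 0"
  shows "(\<lambda>x. newton_cotes_iter A f m x - z) \<in> O[nhds z](\<lambda>x. (x - z) ^ Suc (Suc m))"
  using assms(2)
proof (induction m)
  case 0
  show ?case
    \<comment> \<open>For y = z the assumed estimate is trivial, and the spacing (z - x) / 0 = 0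
      puts the single node at \<open>x\<close>, so the step yields Newton's function.\<close>
    using newton_cotes_step [OF closed_newton_cotes_rule_0 0 assms(3,4), of "\<lambda>_. z"] by simp
next
  case (Suc m)
  have "closed_newton_cotes_rule (Suc m)
      (\<lambda>i. real_of_int (A (Suc m) i) / real_of_int (\<Sum>i\<le>Suc m. A (Suc m) i))"
    using assms(1) [of "Suc m"] by (simp add: newton_cotes_weights_def Let_def)
  moreover have "times_differentiable_near (Suc (Suc m)) f z"
    by (rule times_differentiable_near_mono [OF Suc.prems]) simp
  ultimately show ?case
    unfolding newton_cotes_iter_Suc_normalized
    by (intro newton_cotes_step Suc assms(3,4))
qed

text \<open>Only \<open>f\<close> and \<open>deriv f\<close> enter at each stage, so a single order
  is lost in total, however large \<open>m\<close> is. The fixed point is carried through the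
  induction because it places all nodes at \<open>z\<close> when x = z; there the weighted sum of
  derivatives is \<open>deriv f z\<close>, and the quotient is smooth enough.\<close>

lemma times_differentiable_near_newton_cotes_iter:
  assumes "\<And>m. m \<ge> 1 \<Longrightarrow> newton_cotes_weights m (A m)"
    and f: "times_differentiable_near (Suc k) f z" "f z = 0" "deriv f z \<noteq> 0"
  shows "times_differentiable_near k (newton_cotes_iter A f m) z \<and> newton_cotes_iter A f m z = z"
proof (induction m)
  case 0
  have "times_differentiable_near k (\<lambda>x. x - f x / deriv f x) z"
    using times_differentiable_near_mono [OF f(1), of k] times_differentiable_near_SucD(2) [OF f(1)] f(3)
    by (intro times_differentiable_near_diff times_differentiable_near_divide
        times_differentiable_near_ident) simp_all
  moreover have "newton_cotes_iter A f 0 = (\<lambda>x. x - f x / deriv f x)" by auto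
  ultimately show ?case using f(2) by simp
next
  case (Suc m)
  let ?t = "newton_cotes_iter A f m"
  define w where "w i = real_of_int (A (Suc m) i) / real_of_int (\<Sum>i\<le>Suc m. A (Suc m) i)" for i
  define u where "u i x = x + real i * ((?t x - x) / real (Suc m))" for i x
  have "closed_newton_cotes_rule (Suc m) w"
    using assms(1) [of "Suc m"] by (simp add: newton_cotes_weights_def Let_def w_def [abs_def])
  then have w: "(\<Sum>i\<le>Suc m. w i) = 1" by (rule closed_newton_cotes_rule_sum)
  have uz: "u i z = z" for i using Suc by (simp add: u_def)
  have u: "times_differentiable_near k (u i) z" for i
    unfolding u_def [abs_def]
    by (intro times_differentiable_near_add times_differentiable_near_mult
        times_differentiable_near_divide times_differentiable_near_diff
        times_differentiable_near_ident times_differentiable_near_const) (use Suc in auto)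
  have "(\<Sum>i\<le>Suc m. w i * deriv f (u i z)) = deriv f z"
    unfolding uz sum_distrib_right [symmetric] w by simp
  then have B_nz: "(\<Sum>i\<le>Suc m. w i * deriv f (u i z)) \<noteq> 0" using f(3) by simp
  have "times_differentiable_near k (\<lambda>x. deriv f (u i x)) z" for i
    using times_differentiable_near_compose [of k "deriv f", OF _ u]
      times_differentiable_near_SucD(2) [OF f(1)] by (simp only: uz)
  then have "times_differentiable_near k (\<lambda>x. \<Sum>i\<le>Suc m. w i * deriv f (u i x)) z"
    by (intro times_differentiable_near_sum times_differentiable_near_mult
        times_differentiable_near_const)
  moreover have "times_differentiable_near k f z"
    by (rule times_differentiable_near_mono [OF f(1)]) simp
  ultimately have "times_differentiable_near k
      (\<lambda>x. x - f x / (\<Sum>i\<le>Suc m. w i * deriv f (u i x))) z"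
    using B_nz
    by (intro times_differentiable_near_diff times_differentiable_near_divide
        times_differentiable_near_ident)
  moreover have "newton_cotes_iter A f (Suc m) =
      (\<lambda>x. x - f x / (\<Sum>i\<le>Suc m. w i * deriv f (u i x)))"
    by (simp only: fun_eq_iff newton_cotes_iter_Suc_normalized w_def u_def) simp
  ultimately show ?case using f(2) by (simp only:) simp
qed

theorem theorem3p1:
  fixes f :: "real \<Rightarrow> real" and z :: real and n :: nat
    and A :: "nat \<Rightarrow> nat \<Rightarrow> int"
  assumes "n \<ge> 1"
    and "\<And>m. m \<ge> 1 \<Longrightarrow> newton_cotes_weights m (A m)"
    and "continuously_differentiable_near (n + 2) f z"
    and "f z = 0" and "deriv f z \<noteq> 0"
  shows "convergence_order_at_least (n + 2) (newton_cotes_iter A f n) z"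
proof -
  let ?t = "newton_cotes_iter A f n"
  have f: "times_differentiable_near (Suc (Suc n)) f z"
    using assms(3) unfolding continuously_differentiable_near_def times_differentiable_near_iff
    by (auto simp: eventually_nhds)
  have t: "times_differentiable_near (Suc n) ?t z" "?t z = z"
    using times_differentiable_near_newton_cotes_iter [OF assms(2) f assms(4,5)] by auto
  have "(deriv ^^ j) ?t z = 0" if j: "1 \<le> j" "j \<le> Suc n" for j
  proof -
    obtain i where i: "j = Suc i" using j by (cases j) auto
    \<comment> \<open>The estimate concerns t - z, whose derivatives of positive order are those of
      t; hence j = 0 is excluded.\<close>
    let ?s = "\<lambda>x. ?t x - z"
    have s: "times_differentiable_near (Suc n) ?s z"
      by (intro times_differentiable_near_diff t times_differentiable_near_const)
    have "(deriv ^^ j) ?s z = 0"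
      by (rule bigo_imp_higher_deriv_eq_0 [OF s newton_cotes_iter_bigo [OF assms(2) f assms(4,5)] j(2)])
    moreover have "deriv ?s = deriv ?t"
      by (simp add: fun_eq_iff deriv_def has_field_derivative_iff)
    ultimately show ?thesis unfolding i by (simp add: funpow_swap1)
  qed
  moreover have "times_differentiable_at (n + 1) ?t z"
    using t(1) unfolding times_differentiable_at_def times_differentiable_near_iff
    by (auto dest: eventually_nhds_x_imp_x)
  ultimately show ?thesis
    using t(2) unfolding convergence_order_at_least_def by auto
qed

end
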